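(* Let $n$ be an even positive integer, $m$ a positive integer, and $a,b$ non-negative integers with $a+b=n$. Let $x_1,\ldots,x_a,y_1,\ldots,y_b$ be complex numbers with $x_1+\cdots+x_a+y_1+\cdots+y_b=0$. Define \[ R_{1,2}(m,n;\tau)= mn\, i^{a}q^{-\frac{n}{4}}\sum_{\substack{r_1,\ldots,r_a,s_1,\ldots,s_b\in\mathbb{Z}\\ 2(r_1+\cdots+r_a+s_1+\cdots+s_b)+n=0}}(-1)^{r_1+\cdots+r_a}q^{r_1^2+\cdots+r_a^2+s_1^2+\cdots+s_b^2}e^{2i(r_1x_1+\cdots+r_ax_a+s_1y_1+\cdots+s_by_b)}. \] Then for all $z\in\mathbb{C}$: if $ma$ is even, \[ \sum_{k=0}^{mn-1}\prod_{j=1}^{a}\vartheta_1\!\left(z+x_j+\tfrac{k\pi}{mn}\Big|\tau\right)\prod_{i=1}^{b}\vartheta_2\!\left(z+y_i+\tfrac{k\pi}{mn}\Big|\tau\right)=R_{1,2}(m,n;\tau)\,\vartheta_3(mnz\,|\,m^2n\tau); \] if $ma$ is odd, the same left-hand side equals $R_{1,2}(m,n;\tau)\,\vartheta_4(mnz\,|\,m^2n\tau)$.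
   Context: Throughout, $\tau\in\mathbb{C}$ with $\Im(\tau)>0$, $q=e^{\pi i\tau}$, and $q^{\alpha}$ means $e^{\pi i\alpha\tau}$ for real $\alpha$. The Jacobi theta functions are $\vartheta_1(z|\tau)=-iq^{1/4}\sum_{n\in\mathbb{Z}}(-1)^nq^{n(n+1)}e^{(2n+1)iz}$, $\vartheta_2(z|\tau)=q^{1/4}\sum_{n\in\mathbb{Z}}q^{n(n+1)}e^{(2n+1)iz}$, $\vartheta_3(z|\tau)=\sum_{n\in\mathbb{Z}}q^{n^2}e^{2niz}$, $\vartheta_4(z|\tau)=\sum_{n\in\mathbb{Z}}(-1)^nq^{n^2}e^{2niz}$; and $\vartheta_j(z|m^2n\tau)$ denotes the same function with $\tau$ replaced by $m^2n\tau$. An empty product equals $1$ (so $a=0$ or $b=0$ is allowed).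
   Formalization: The factor i^a in R_{1,2} is corrected to (-i)^a; with the given ϑ_1 the printed formula has the wrong sign for odd a (e.g. m=1, n=2, a=b=1, y_1=-x_1, z=0), and the two agree for even a. *)

theory Defs
  imports "HOL-Analysis.Analysis"
begin

(* With q = exp (pi i tau), q_pow tau alpha is the branch exp (pi i alpha tau) of q^alpha,
   not a principal power of q. *)
definition q_pow :: "complex \<Rightarrow> real \<Rightarrow> complex" where
  "q_pow \<tau> \<alpha> = exp (of_real pi * \<i> * of_real \<alpha> * \<tau>)"

definition jtheta1 :: "complex \<Rightarrow> complex \<Rightarrow> complex" where
  "jtheta1 z \<tau> = - \<i> * q_pow \<tau> (1/4) *
     (\<Sum>\<^sub>\<infinity>n::int. (-1) powi n * q_pow \<tau> (of_int (n * (n + 1))) * exp (of_int (2 * n + 1) * \<i> * z))"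

definition jtheta2 :: "complex \<Rightarrow> complex \<Rightarrow> complex" where
  "jtheta2 z \<tau> = q_pow \<tau> (1/4) *
     (\<Sum>\<^sub>\<infinity>n::int. q_pow \<tau> (of_int (n * (n + 1))) * exp (of_int (2 * n + 1) * \<i> * z))"

definition jtheta3 :: "complex \<Rightarrow> complex \<Rightarrow> complex" where
  "jtheta3 z \<tau> =
     (\<Sum>\<^sub>\<infinity>n::int. q_pow \<tau> (of_int (n\<^sup>2)) * exp (of_int (2 * n) * \<i> * z))"

definition jtheta4 :: "complex \<Rightarrow> complex \<Rightarrow> complex" where
  "jtheta4 z \<tau> =
     (\<Sum>\<^sub>\<infinity>n::int. (-1) powi n * q_pow \<tau> (of_int (n\<^sup>2)) * exp (of_int (2 * n) * \<i> * z))"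

(* Integer tuples (r_1,...,r_a) and (s_1,...,s_b) are extensional functions on {1..a} and {1..b},
   so that each tuple is counted exactly once. *)
definition R12_index :: "nat \<Rightarrow> nat \<Rightarrow> nat \<Rightarrow> ((nat \<Rightarrow> int) \<times> (nat \<Rightarrow> int)) set" where
  "R12_index n a b =
     {(r, s). r \<in> {1..a} \<rightarrow>\<^sub>E UNIV \<and> s \<in> {1..b} \<rightarrow>\<^sub>E UNIV \<and>
              2 * ((\<Sum>j=1..a. r j) + (\<Sum>j=1..b. s j)) + int n = 0}"

(* The factor (-i)^a comes from the factor -i in each of the a copies of jtheta1.  The source prints
   i^a here, a sign slip that matters exactly when a is odd: for m = 1, n = 2, a = b = 1, z = 0,
   y_1 = -x_1, the sum of products is 2 theta_1(x_1|tau) theta_2(x_1|tau)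
   = 2 theta_1(2 x_1|2 tau) theta_4(0|2 tau), whereas i^a would give the negative of this. *)
definition R12 ::
  "nat \<Rightarrow> nat \<Rightarrow> nat \<Rightarrow> nat \<Rightarrow> (nat \<Rightarrow> complex) \<Rightarrow> (nat \<Rightarrow> complex) \<Rightarrow> complex \<Rightarrow> complex" where
  "R12 m n a b x y \<tau> =
     of_nat (m * n) * (- \<i>) ^ a * q_pow \<tau> (- (real n / 4)) *
     (\<Sum>\<^sub>\<infinity>(r, s)\<in>R12_index n a b.
        (-1) powi (\<Sum>j=1..a. r j) *
        q_pow \<tau> (of_int ((\<Sum>j=1..a. (r j)\<^sup>2) + (\<Sum>j=1..b. (s j)\<^sup>2))) *
        exp (2 * \<i> * ((\<Sum>j=1..a. of_int (r j) * x j) + (\<Sum>j=1..b. of_int (s j) * y j))))"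

end

theory Submission
  imports Defs
begin

text \<open>
  Expanding a product of theta series with terms \<open>\<epsilon>\<^sup>r q\<^bsup>r\<^sup>2\<^esup> exp (2 i r w)\<close> gives a sum over integer
  vectors \<open>g\<close>, and translating all arguments by \<open>u = k \<pi> / N\<close> is felt by \<open>g\<close> only through its
  coordinate sum. Weighting with \<open>exp (- 2 i s u)\<close> and summing over \<open>k < N\<close> therefore keeps exactly
  the vectors whose coordinate sum is congruent to \<open>s\<close> modulo \<open>N\<close>. When \<open>N\<close> is \<open>m\<close> times the number
  of factors, these are the translates by the constant vectors \<open>m l\<close> of the vectors with coordinate
  sum \<open>s\<close>. Such a translation multiplies the term of \<open>g\<close> by a quantity that depends only on \<open>l\<close> and
  \<open>s\<close>, so the double sum factors, the sum over \<open>l\<close> being again a theta series.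

  The functions \<open>\<vartheta>\<^sub>1\<close> and \<open>\<vartheta>\<^sub>2\<close> are such series translated by half the quasi-period \<open>\<pi> \<tau>\<close>, up to
  exponential factors that amount to \<open>s = - n / 2\<close>; for this \<open>s\<close> the half quasi-periods cancel in
  the argument of the resulting series.
\<close>

section \<open>Infinite sums\<close>

lemma has_sum_sum:
  fixes f :: "'k \<Rightarrow> 'a \<Rightarrow> 'b::topological_comm_monoid_add"
  assumes "\<And>k. k \<in> K \<Longrightarrow> (f k has_sum S k) A"
  shows "((\<lambda>x. \<Sum>k\<in>K. f k x) has_sum sum S K) A"
  using assms by (induction K rule: infinite_finite_induct) (simp_all add: has_sum_add)

lemma infsum_sum:
  fixes f :: "'k \<Rightarrow> 'a \<Rightarrow> 'b::{topological_comm_monoid_add, t2_space}"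
  assumes "\<And>k. k \<in> K \<Longrightarrow> f k summable_on A"
  shows "(\<Sum>\<^sub>\<infinity>x\<in>A. \<Sum>k\<in>K. f k x) = (\<Sum>k\<in>K. infsum (f k) A)"
  using assms by (intro infsumI has_sum_sum has_sum_infsum)

lemma infsum_product:
  fixes f :: "'a \<Rightarrow> 'c::{banach, real_normed_field, second_countable_topology}"
  assumes "(\<lambda>x. norm (f x)) summable_on A" and "(\<lambda>y. norm (g y)) summable_on B"
  shows "(\<Sum>\<^sub>\<infinity>(x, y)\<in>A \<times> B. f x * g y) = infsum f A * infsum g B"
proof -
  have "(\<lambda>c. norm (case c of (x, y) \<Rightarrow> f x * g y)) summable_on A \<times> B"
    unfolding Infinite_Sum.abs_summable_on_Sigma_iff
    using assms
    by (simp add: norm_mult infsum_cmult_right' infsum_nonneg summable_on_cmult_left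
        summable_on_cmult_right)
  then have "(\<lambda>(x, y). f x * g y) summable_on A \<times> B"
    by (rule abs_summable_summable)
  then have "(\<Sum>\<^sub>\<infinity>(x, y)\<in>A \<times> B. f x * g y) = (\<Sum>\<^sub>\<infinity>x\<in>A. \<Sum>\<^sub>\<infinity>y\<in>B. f x * g y)"
    by (rule infsum_Sigma'_banach[symmetric])
  then show ?thesis
    by (simp only: infsum_cmult_left' infsum_cmult_right')
qed

lemma summable_on_int_if_nat:
  fixes f :: "int \<Rightarrow> 'a::{uniform_topological_group_add, topological_comm_monoid_add,
    ab_group_add, complete_uniform_space}"
  assumes "(\<lambda>n. f (int n)) summable_on UNIV" and "(\<lambda>n. f (- int n)) summable_on UNIV"
  shows "f summable_on UNIV"
proof -
  have "f summable_on range int"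
    using assms(1) by (simp add: summable_on_reindex o_def)
  moreover have "f summable_on range (\<lambda>n. - int n)"
    using assms(2) by (simp add: summable_on_reindex o_def inj_on_def)
  moreover have "k \<in> range int \<union> range (\<lambda>n. - int n)" for k
    by (cases k rule: int_cases2) auto
  then have "range int \<union> range (\<lambda>n. - int n) = UNIV"
    by blast
  ultimately show ?thesis
    using summable_on_union[of f "range int" "range (\<lambda>n. - int n)"] by simp
qed

lemma summable_on_exp_minus_abs_int: "(\<lambda>k::int. exp (- \<bar>real_of_int k\<bar>)) summable_on UNIV"
proof -
  have "summable (\<lambda>n. exp (-1::real) ^ n)"
    by (rule summable_geometric) simp
  then have "(\<lambda>n. exp (- real n)) summable_on UNIV"
    by (simp add: summable_on_UNIV_nonneg_real_iff exp_of_nat_mult[symmetric])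
  then show ?thesis
    by (intro summable_on_int_if_nat) simp_all
qed

section \<open>Sums over roots of unity\<close>

lemma exp_2pi_int_div_eq_1_iff:
  assumes "N > 0"
  shows "exp (2 * \<i> * of_int t * (of_real pi / of_nat N)) = 1 \<longleftrightarrow> int N dvd t"
proof -
  have "exp (2 * \<i> * of_int t * (of_real pi / of_nat N)) = 1
      \<longleftrightarrow> (\<exists>l::int. 2 * real_of_int t * pi / real N = of_int (2 * l) * pi)"
    by (simp add: exp_eq_1)
  also have "\<dots> \<longleftrightarrow> (\<exists>l::int. real_of_int t = of_int (int N * l))"
    using assms by (simp add: field_simps)
  also have "\<dots> \<longleftrightarrow> int N dvd t"
    by (simp only: of_int_eq_iff dvd_def)
  finally show ?thesis .
qed

lemma sum_exp_2pi_int_div: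
  assumes "N > 0"
  shows "(\<Sum>k=0..<N. exp (2 * \<i> * of_int t * (of_nat k * of_real pi / of_nat N)))
       = (if int N dvd t then of_nat N else 0)"
proof -
  define \<omega> where "\<omega> = exp (2 * \<i> * of_int t * (of_real pi / of_nat N))"
  have "exp (2 * \<i> * of_int t * (of_nat k * of_real pi / of_nat N)) = \<omega> ^ k" for k
    by (simp add: \<omega>_def exp_of_nat_mult[symmetric] algebra_simps)
  then have sum: "(\<Sum>k=0..<N. exp (2 * \<i> * of_int t * (of_nat k * of_real pi / of_nat N)))
      = (\<Sum>k<N. \<omega> ^ k)"
    by (simp add: atLeast0LessThan)
  have \<omega>_eq_1_iff: "\<omega> = 1 \<longleftrightarrow> int N dvd t"
    unfolding \<omega>_def by (rule exp_2pi_int_div_eq_1_iff[OF assms])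
  have "\<omega> ^ N = exp (\<i> * (of_int t * (of_real pi * 2)))"
    using assms by (simp add: \<omega>_def exp_of_nat_mult[symmetric] algebra_simps)
  then have "\<omega> ^ N = 1"
    by simp
  then show ?thesis
    unfolding sum \<omega>_eq_1_iff[symmetric] by (simp add: geometric_sum)
qed

section \<open>Terms of theta series\<close>

lemma q_pow_add: "q_pow \<tau> (\<alpha> + \<beta>) = q_pow \<tau> \<alpha> * q_pow \<tau> \<beta>"
  by (simp add: q_pow_def exp_add[symmetric] algebra_simps)

lemma q_pow_sum: "finite I \<Longrightarrow> q_pow \<tau> (sum f I) = (\<Prod>i\<in>I. q_pow \<tau> (f i))"
  by (simp add: q_pow_def exp_sum sum_distrib_left sum_distrib_right)

lemma q_pow_power: "q_pow \<tau> \<alpha> ^ n = q_pow \<tau> (of_nat n * \<alpha>)"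
  by (simp add: q_pow_def exp_of_nat_mult[symmetric] algebra_simps)

lemma power_int_sum:
  fixes x :: "'a::field"
  assumes "x \<noteq> 0"
  shows "x powi (sum f I) = (\<Prod>i\<in>I. x powi f i)"
  using assms by (induction I rule: infinite_finite_induct) (simp_all add: power_int_add)

lemma prod_power_int: "(\<Prod>i\<in>I. f i powi k) = (\<Prod>i\<in>I. f i :: 'a::field) powi k"
  by (induction I rule: infinite_finite_induct) (simp_all add: power_int_mult_distrib)

definition theta_term :: "complex \<Rightarrow> complex \<Rightarrow> complex \<Rightarrow> int \<Rightarrow> complex" where
  "theta_term \<epsilon> \<tau> v k = \<epsilon> powi k * q_pow \<tau> (of_int (k\<^sup>2)) * exp (of_int (2 * k) * \<i> * v)"

lemma theta_term_eq_exp: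
  "theta_term \<epsilon> \<tau> v k = \<epsilon> powi k * exp (of_real pi * \<i> * (of_int k)\<^sup>2 * \<tau> + 2 * \<i> * of_int k * v)"
  by (simp add: theta_term_def q_pow_def exp_add mult_ac)

lemma theta_term_add_arg:
  "theta_term \<epsilon> \<tau> (u + v) k = exp (2 * \<i> * of_int k * u) * theta_term \<epsilon> \<tau> v k"
  by (simp add: theta_term_eq_exp exp_add[symmetric] algebra_simps)

lemma theta_term_add_index:
  assumes "\<epsilon> \<noteq> 0"
  shows "theta_term \<epsilon> \<tau> v (k + l) =
    theta_term \<epsilon> \<tau> v k * theta_term \<epsilon> \<tau> (v + of_int k * of_real pi * \<tau>) l"
  using assms
  by (simp add: theta_term_eq_exp power_int_add exp_add[symmetric] power2_eq_square algebra_simps)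

lemma theta_term_mult_index:
  "theta_term \<epsilon> \<tau> v (int m * l) = theta_term (\<epsilon> ^ m) (of_nat (m\<^sup>2) * \<tau>) (of_nat m * v) l"
  by (simp add: theta_term_eq_exp power_int_mult power_mult_distrib) (simp add: mult_ac)

lemma prod_theta_term_same_index:
  assumes "finite I"
  shows "(\<Prod>i\<in>I. theta_term (\<epsilon> i) \<tau> (w i) k) =
    theta_term (prod \<epsilon> I) (of_nat (card I) * \<tau>) (sum w I) k"
  using assms
  by (simp add: theta_term_eq_exp prod.distrib prod_power_int sum.distrib mult_ac
      flip: exp_sum sum_distrib_left sum_distrib_right)

lemma prod_theta_term_add_arg:
  assumes "finite I"
  shows "(\<Prod>i\<in>I. theta_term (\<epsilon> i) \<tau> (u + w i) (g i)) =
    exp (2 * \<i> * of_int (sum g I) * u) * (\<Prod>i\<in>I. theta_term (\<epsilon> i) \<tau> (w i) (g i))"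
  using assms
  by (simp add: theta_term_add_arg prod.distrib exp_sum[symmetric] sum_distrib_left
      sum_distrib_right)

lemma prod_theta_term_translate:
  assumes "finite I" and "\<forall>i\<in>I. \<epsilon> i \<noteq> 0"
  shows "(\<Prod>i\<in>I. theta_term (\<epsilon> i) \<tau> (w i) (g i + int m * l)) =
    (\<Prod>i\<in>I. theta_term (\<epsilon> i) \<tau> (w i) (g i)) *
    theta_term (prod \<epsilon> I ^ m) (of_nat (m\<^sup>2 * card I) * \<tau>)
      (of_nat m * (sum w I + of_int (sum g I) * of_real pi * \<tau>)) l"
proof -
  have "(\<Prod>i\<in>I. theta_term (\<epsilon> i) \<tau> (w i) (g i + int m * l)) =
      (\<Prod>i\<in>I. theta_term (\<epsilon> i) \<tau> (w i) (g i)) *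
      (\<Prod>i\<in>I. theta_term (\<epsilon> i) \<tau> (w i + of_int (g i) * of_real pi * \<tau>) (int m * l))"
    using assms(2) by (simp add: theta_term_add_index prod.distrib)
  also have "(\<Prod>i\<in>I. theta_term (\<epsilon> i) \<tau> (w i + of_int (g i) * of_real pi * \<tau>) (int m * l)) =
      theta_term (prod \<epsilon> I) (of_nat (card I) * \<tau>)
        (sum w I + of_int (sum g I) * of_real pi * \<tau>) (int m * l)"
    using assms(1) by (simp add: prod_theta_term_same_index sum.distrib sum_distrib_right)
  finally show ?thesis
    by (simp only: theta_term_mult_index of_nat_mult mult.assoc)
qed

lemma norm_theta_term:
  assumes "norm \<epsilon> = 1"
  shows "norm (theta_term \<epsilon> \<tau> v k) = exp (- (pi * Im \<tau>) * (of_int k)\<^sup>2 - 2 * of_int k * Im v)"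
  using assms by (simp add: theta_term_eq_exp norm_mult norm_power_int power2_eq_square)

lemma quadratic_le_minus_abs:
  fixes c d t :: real
  assumes "c > 0"
  shows "- c * t\<^sup>2 - 2 * t * d \<le> (2 * \<bar>d\<bar> + 1)\<^sup>2 / (4 * c) - \<bar>t\<bar>"
proof -
  define B where "B = 2 * \<bar>d\<bar> + 1"
  have "0 \<le> c * (\<bar>t\<bar> - B / (2 * c))\<^sup>2"
    using assms by simp
  also have "\<dots> = c * t\<^sup>2 - B * \<bar>t\<bar> + B\<^sup>2 / (4 * c)"
    using assms by (simp add: power2_eq_square field_simps)
  finally have "B * \<bar>t\<bar> - c * t\<^sup>2 \<le> B\<^sup>2 / (4 * c)"
    by simp
  moreover have "- (t * d) \<le> \<bar>t\<bar> * \<bar>d\<bar>"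
    by (metis abs_ge_minus_self abs_mult)
  ultimately show ?thesis
    by (simp add: B_def algebra_simps)
qed

lemma theta_term_abs_summable:
  assumes "Im \<tau> > 0" and "norm \<epsilon> = 1"
  shows "(\<lambda>k. norm (theta_term \<epsilon> \<tau> v k)) summable_on UNIV"
proof -
  define C where "C = (2 * \<bar>Im v\<bar> + 1)\<^sup>2 / (4 * (pi * Im \<tau>))"
  have "(\<lambda>k::int. exp C * exp (- \<bar>real_of_int k\<bar>)) summable_on UNIV"
    by (rule summable_on_cmult_right[OF summable_on_exp_minus_abs_int])
  moreover have "norm (theta_term \<epsilon> \<tau> v k) \<le> exp C * exp (- \<bar>real_of_int k\<bar>)" for k
    using quadratic_le_minus_abs[of "pi * Im \<tau>" "of_int k" "Im v"] assms
    by (simp add: norm_theta_term C_def flip: exp_add)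
  ultimately show ?thesis
    by (rule summable_on_comparison_test) simp_all
qed

lemma prod_theta_term_abs_summable:
  assumes "Im \<tau> > 0" and "finite I" and "\<forall>i\<in>I. norm (\<epsilon> i) = 1"
  shows "(\<lambda>g. norm (\<Prod>i\<in>I. theta_term (\<epsilon> i) \<tau> (w i) (g i))) summable_on I \<rightarrow>\<^sub>E UNIV"
  unfolding abs_summable_equivalent
  by (rule abs_summable_on_prod_PiE)
    (use assms theta_term_abs_summable[unfolded abs_summable_equivalent] in auto)

section \<open>Integer tuples with prescribed sum\<close>

definition tuples_with_sum :: "'i set \<Rightarrow> int \<Rightarrow> ('i \<Rightarrow> int) set" where
  "tuples_with_sum I s = {g \<in> I \<rightarrow>\<^sub>E UNIV. sum g I = s}"

definition tuples_with_sum_mod :: "'i set \<Rightarrow> nat \<Rightarrow> int \<Rightarrow> ('i \<Rightarrow> int) set" where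
  "tuples_with_sum_mod I N s = {g \<in> I \<rightarrow>\<^sub>E UNIV. int N dvd sum g I - s}"

lemma bij_betw_translate_tuples:
  assumes "m > 0" and "card I > 0"
  shows "bij_betw (\<lambda>(g, l). \<lambda>i\<in>I. g i + int m * l)
    (tuples_with_sum I s \<times> UNIV) (tuples_with_sum_mod I (m * card I) s)"
    (is "bij_betw ?translate _ _")
proof (rule bij_betwI')
  have sum_translate: "sum (?translate (g, l)) I = sum g I + int (m * card I) * l" for g l
    by (simp add: sum.distrib)
  show "?translate c = ?translate d \<longleftrightarrow> c = d"
    if "c \<in> tuples_with_sum I s \<times> UNIV" and "d \<in> tuples_with_sum I s \<times> UNIV" for c d
  proof
    obtain g l h k where c: "c = (g, l)" and d: "d = (h, k)"
      by (metis surj_pair)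
    assume eq: "?translate c = ?translate d"
    have "s + int (m * card I) * l = s + int (m * card I) * k"
      using that arg_cong[OF eq, of "\<lambda>f. sum f I"]
      unfolding c d sum_translate by (simp add: tuples_with_sum_def)
    then have "l = k"
      using assms by simp
    moreover have "g i = h i" if "i \<in> I" for i
      using fun_cong[OF eq, of i] that \<open>l = k\<close> by (simp add: c d)
    then have "g = h"
      using that by (intro PiE_ext[of g I "\<lambda>_. UNIV"]) (auto simp: c d tuples_with_sum_def)
    ultimately show "c = d"
      by (simp add: c d)
  qed simp
  show "?translate c \<in> tuples_with_sum_mod I (m * card I) s"
    if "c \<in> tuples_with_sum I s \<times> UNIV" for c
    using that sum_translate by (auto simp: tuples_with_sum_mod_def tuples_with_sum_def)
  show "\<exists>c \<in> tuples_with_sum I s \<times> UNIV. g = ?translate c"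
    if g: "g \<in> tuples_with_sum_mod I (m * card I) s" for g
  proof -
    obtain l where l: "sum g I - s = int (m * card I) * l"
      using g by (auto simp: tuples_with_sum_mod_def elim: dvdE)
    have "(\<lambda>i\<in>I. g i - int m * l) \<in> tuples_with_sum I s"
      using l by (simp add: tuples_with_sum_def sum_subtractf algebra_simps)
    moreover have "?translate (\<lambda>i\<in>I. g i - int m * l, l) = g"
      using g by (auto simp: tuples_with_sum_mod_def cong: restrict_cong)
    ultimately show ?thesis
      by (metis SigmaI UNIV_I)
  qed
qed

section \<open>Theta series\<close>

definition theta_series :: "complex \<Rightarrow> complex \<Rightarrow> complex \<Rightarrow> complex" where
  "theta_series \<epsilon> \<tau> v = (\<Sum>\<^sub>\<infinity>k. theta_term \<epsilon> \<tau> v k)"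

lemma jtheta3_eq_theta_series: "jtheta3 z \<tau> = theta_series 1 \<tau> z"
  by (simp add: jtheta3_def theta_series_def theta_term_def)

lemma jtheta4_eq_theta_series: "jtheta4 z \<tau> = theta_series (-1) \<tau> z"
  by (simp add: jtheta4_def theta_series_def theta_term_def)

lemma theta_term_half_quasi_period:
  "exp (\<i> * z) * theta_term \<epsilon> \<tau> (z + of_real pi * \<tau> / 2) k =
    \<epsilon> powi k * q_pow \<tau> (of_int (k * (k + 1))) * exp (of_int (2 * k + 1) * \<i> * z)"
  by (simp add: theta_term_eq_exp q_pow_def exp_add[symmetric] power2_eq_square algebra_simps)

lemma theta_series_half_quasi_period:
  "exp (\<i> * z) * theta_series \<epsilon> \<tau> (z + of_real pi * \<tau> / 2) =
    (\<Sum>\<^sub>\<infinity>k. \<epsilon> powi k * q_pow \<tau> (of_int (k * (k + 1))) * exp (of_int (2 * k + 1) * \<i> * z))"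
  unfolding theta_series_def infsum_cmult_right'[symmetric] theta_term_half_quasi_period ..

lemma jtheta1_eq_theta_series:
  "jtheta1 z \<tau> = - \<i> * q_pow \<tau> (1/4) * exp (\<i> * z) * theta_series (-1) \<tau> (z + of_real pi * \<tau> / 2)"
  by (simp only: jtheta1_def theta_series_half_quasi_period mult.assoc)

lemma jtheta2_eq_theta_series:
  "jtheta2 z \<tau> = q_pow \<tau> (1/4) * exp (\<i> * z) * theta_series 1 \<tau> (z + of_real pi * \<tau> / 2)"
  by (simp only: jtheta2_def theta_series_half_quasi_period mult.assoc power_int_1_left mult_1)

lemma prod_theta_series:
  assumes "Im \<tau> > 0" and "finite I" and "\<forall>i\<in>I. norm (\<epsilon> i) = 1"
  shows "(\<Prod>i\<in>I. theta_series (\<epsilon> i) \<tau> (w i)) =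
    (\<Sum>\<^sub>\<infinity>g\<in>I \<rightarrow>\<^sub>E UNIV. \<Prod>i\<in>I. theta_term (\<epsilon> i) \<tau> (w i) (g i))"
  unfolding theta_series_def
  by (rule infsum_prod_PiE_abs[symmetric]) (use assms theta_term_abs_summable in auto)

lemma exp_mult_prod_theta_term:
  assumes "finite I"
  shows "exp (- (2 * \<i> * of_int s * u)) * (\<Prod>i\<in>I. theta_term (\<epsilon> i) \<tau> (u + w i) (g i)) =
    exp (2 * \<i> * of_int (sum g I - s) * u) * (\<Prod>i\<in>I. theta_term (\<epsilon> i) \<tau> (w i) (g i))"
  unfolding prod_theta_term_add_arg[OF assms] mult.assoc[symmetric] exp_add[symmetric]
  by (simp add: algebra_simps)

lemma sum_exp_mult_prod_theta_series:
  assumes "Im \<tau> > 0" and "finite I" and "\<forall>i\<in>I. norm (\<epsilon> i) = 1" and "N > 0"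
  defines "u \<equiv> \<lambda>k. of_nat k * of_real pi / of_nat N"
  shows "(\<Sum>k=0..<N. exp (- (2 * \<i> * of_int s * u k)) *
      (\<Prod>i\<in>I. theta_series (\<epsilon> i) \<tau> (u k + w i))) =
    of_nat N * (\<Sum>\<^sub>\<infinity>g\<in>tuples_with_sum_mod I N s.
      \<Prod>i\<in>I. theta_term (\<epsilon> i) \<tau> (w i) (g i))"
proof -
  define T where "T v = (\<lambda>g. \<Prod>i\<in>I. theta_term (\<epsilon> i) \<tau> (v + w i) (g i))" for v
  have summable: "T v summable_on I \<rightarrow>\<^sub>E UNIV" for v
    unfolding T_def by (rule abs_summable_summable[OF prod_theta_term_abs_summable[OF assms(1-3)]])
  have twist: "exp (- (2 * \<i> * of_int s * u k)) * T (u k) g =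
      exp (2 * \<i> * of_int (sum g I - s) * u k) * T 0 g" for k g
    unfolding T_def exp_mult_prod_theta_term[OF assms(2)] by simp
  have "(\<Sum>k=0..<N. exp (- (2 * \<i> * of_int s * u k)) *
      (\<Prod>i\<in>I. theta_series (\<epsilon> i) \<tau> (u k + w i))) =
      (\<Sum>k=0..<N. \<Sum>\<^sub>\<infinity>g\<in>I \<rightarrow>\<^sub>E UNIV. exp (- (2 * \<i> * of_int s * u k)) * T (u k) g)"
    by (simp only: T_def prod_theta_series[OF assms(1-3)] infsum_cmult_right')
  also have "\<dots> = (\<Sum>\<^sub>\<infinity>g\<in>I \<rightarrow>\<^sub>E UNIV. \<Sum>k=0..<N. exp (- (2 * \<i> * of_int s * u k)) * T (u k) g)"
    by (intro infsum_sum[symmetric] summable_on_cmult_right summable)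
  also have "\<dots> = (\<Sum>\<^sub>\<infinity>g\<in>I \<rightarrow>\<^sub>E UNIV. (if int N dvd sum g I - s then of_nat N else 0) * T 0 g)"
    unfolding twist sum_distrib_right[symmetric]
    unfolding u_def sum_exp_2pi_int_div[OF assms(4)] ..
  also have "\<dots> = (\<Sum>\<^sub>\<infinity>g\<in>tuples_with_sum_mod I N s. of_nat N * T 0 g)"
    by (rule infsum_cong_neutral) (auto simp: tuples_with_sum_mod_def)
  also have "\<dots> = of_nat N * infsum (T 0) (tuples_with_sum_mod I N s)"
    by (rule infsum_cmult_right')
  finally show ?thesis
    by (simp only: T_def add_0)
qed

definition theta_slice ::
  "'i set \<Rightarrow> ('i \<Rightarrow> complex) \<Rightarrow> complex \<Rightarrow> ('i \<Rightarrow> complex) \<Rightarrow> int \<Rightarrow> complex" where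
  "theta_slice I \<epsilon> \<tau> w s =
    (\<Sum>\<^sub>\<infinity>g\<in>tuples_with_sum I s. \<Prod>i\<in>I. theta_term (\<epsilon> i) \<tau> (w i) (g i))"

lemma theta_slice_add_arg:
  assumes "finite I"
  shows "theta_slice I \<epsilon> \<tau> (\<lambda>i. u + w i) s = exp (2 * \<i> * of_int s * u) * theta_slice I \<epsilon> \<tau> w s"
  unfolding theta_slice_def prod_theta_term_add_arg[OF assms] infsum_cmult_right'[symmetric]
  by (rule infsum_cong) (simp add: tuples_with_sum_def)

lemma infsum_prod_theta_term_sum_mod:
  assumes "Im \<tau> > 0" and "\<forall>i\<in>I. norm (\<epsilon> i) = 1" and "m > 0" and "card I > 0"
  shows "(\<Sum>\<^sub>\<infinity>g\<in>tuples_with_sum_mod I (m * card I) s.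
      \<Prod>i\<in>I. theta_term (\<epsilon> i) \<tau> (w i) (g i)) =
    theta_slice I \<epsilon> \<tau> w s * theta_series (prod \<epsilon> I ^ m) (of_nat (m\<^sup>2 * card I) * \<tau>)
      (of_nat m * (sum w I + of_int s * of_real pi * \<tau>))"
proof -
  define T where "T = (\<lambda>g. \<Prod>i\<in>I. theta_term (\<epsilon> i) \<tau> (w i) (g i))"
  define H where "H = theta_term (prod \<epsilon> I ^ m) (of_nat (m\<^sup>2 * card I) * \<tau>)
    (of_nat m * (sum w I + of_int s * of_real pi * \<tau>))"
  have fin: "finite I"
    using assms(4) by (rule card_ge_0_finite)
  have nonzero: "\<forall>i\<in>I. \<epsilon> i \<noteq> 0"
    using assms(2) by force
  have T_translate: "T (\<lambda>i\<in>I. g i + int m * l) = T g * H l" if "g \<in> tuples_with_sum I s" for g l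
    using prod_theta_term_translate[OF fin nonzero, of _ _ g m l] that
    by (simp add: T_def H_def tuples_with_sum_def del: of_int_sum)
  have "(\<lambda>g. norm (T g)) summable_on tuples_with_sum I s"
    unfolding T_def
    by (rule summable_on_subset_banach[OF prod_theta_term_abs_summable[OF assms(1) fin assms(2)]])
      (auto simp: tuples_with_sum_def)
  moreover have "(\<lambda>l. norm (H l)) summable_on UNIV"
    unfolding H_def
  proof (rule theta_term_abs_summable)
    show "Im (of_nat (m\<^sup>2 * card I) * \<tau>) > 0"
      using assms(1,3,4) by simp
    have "norm (prod \<epsilon> I) = (\<Prod>i\<in>I. norm (\<epsilon> i))"
      by (rule prod_norm[symmetric])
    then show "norm (prod \<epsilon> I ^ m) = 1"
      using assms(2) by (simp add: norm_power)
  qed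
  ultimately have "(\<Sum>\<^sub>\<infinity>(g, l)\<in>tuples_with_sum I s \<times> UNIV. T g * H l) =
      infsum T (tuples_with_sum I s) * infsum H UNIV"
    by (rule infsum_product)
  moreover have "(\<Sum>\<^sub>\<infinity>(g, l)\<in>tuples_with_sum I s \<times> UNIV. T g * H l) =
      (\<Sum>\<^sub>\<infinity>c\<in>tuples_with_sum I s \<times> UNIV. T ((\<lambda>(g, l). \<lambda>i\<in>I. g i + int m * l) c))"
    by (rule infsum_cong) (auto simp: T_translate)
  moreover have "\<dots> = infsum T (tuples_with_sum_mod I (m * card I) s)"
    by (rule infsum_reindex_bij_betw[OF bij_betw_translate_tuples[OF assms(3,4)]])
  ultimately show ?thesis
    by (simp only: T_def H_def theta_slice_def theta_series_def)
qed

lemma sum_exp_mult_prod_theta_series_eq_product: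
  assumes "Im \<tau> > 0" and "\<forall>i\<in>I. norm (\<epsilon> i) = 1" and "m > 0" and "card I > 0"
  defines "u \<equiv> \<lambda>k. of_nat k * of_real pi / of_nat (m * card I)"
  shows "(\<Sum>k=0..<m * card I. exp (- (2 * \<i> * of_int s * u k)) *
      (\<Prod>i\<in>I. theta_series (\<epsilon> i) \<tau> (u k + w i))) =
    of_nat (m * card I) * theta_slice I \<epsilon> \<tau> w s *
    theta_series (prod \<epsilon> I ^ m) (of_nat (m\<^sup>2 * card I) * \<tau>)
      (of_nat m * (sum w I + of_int s * of_real pi * \<tau>))"
proof -
  have "(\<Sum>k=0..<m * card I. exp (- (2 * \<i> * of_int s * u k)) *
      (\<Prod>i\<in>I. theta_series (\<epsilon> i) \<tau> (u k + w i))) =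
      of_nat (m * card I) * (\<Sum>\<^sub>\<infinity>g\<in>tuples_with_sum_mod I (m * card I) s.
        \<Prod>i\<in>I. theta_term (\<epsilon> i) \<tau> (w i) (g i))"
    unfolding u_def
    by (rule sum_exp_mult_prod_theta_series)
      (use assms card_ge_0_finite[OF assms(4)] in \<open>simp_all del: of_nat_mult\<close>)
  then show ?thesis
    unfolding infsum_prod_theta_term_sum_mod[OF assms(1-4)] by (simp only: mult.assoc)
qed

corollary sum_exp_mult_prod_theta_series_zero_sum:
  assumes "Im \<tau> > 0" and "\<forall>i\<in>I. norm (\<epsilon> i) = 1" and "m > 0" and "card I > 0"
    and "sum w I = 0"
  defines "u \<equiv> \<lambda>k. of_nat k * of_real pi / of_nat (m * card I)"
  shows "(\<Sum>k=0..<m * card I. exp (- (2 * \<i> * of_int s * (v + u k))) *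
      (\<Prod>i\<in>I. theta_series (\<epsilon> i) \<tau> (v + u k + w i))) =
    of_nat (m * card I) * theta_slice I \<epsilon> \<tau> w s *
    theta_series (prod \<epsilon> I ^ m) (of_nat (m\<^sup>2 * card I) * \<tau>)
      (of_nat (m * card I) * v + of_nat m * of_int s * of_real pi * \<tau>)"
proof -
  have sum_arg: "of_nat m * ((\<Sum>i\<in>I. v + w i) + of_int s * of_real pi * \<tau>) =
      of_nat (m * card I) * v + of_nat m * of_int s * of_real pi * \<tau>"
    using assms(5) by (simp add: sum.distrib distrib_left mult.assoc)
  have "(\<Sum>k=0..<m * card I. exp (- (2 * \<i> * of_int s * (v + u k))) *
      (\<Prod>i\<in>I. theta_series (\<epsilon> i) \<tau> (v + u k + w i))) =
      exp (- (2 * \<i> * of_int s * v)) * (\<Sum>k=0..<m * card I. exp (- (2 * \<i> * of_int s * u k)) *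
      (\<Prod>i\<in>I. theta_series (\<epsilon> i) \<tau> (u k + (v + w i))))"
    by (simp add: sum_distrib_left distrib_left exp_diff exp_minus field_simps)
  also have "\<dots> = exp (- (2 * \<i> * of_int s * v)) *
      (of_nat (m * card I) * theta_slice I \<epsilon> \<tau> (\<lambda>i. v + w i) s *
      theta_series (prod \<epsilon> I ^ m) (of_nat (m\<^sup>2 * card I) * \<tau>)
        (of_nat (m * card I) * v + of_nat m * of_int s * of_real pi * \<tau>))"
    unfolding u_def sum_exp_mult_prod_theta_series_eq_product[OF assms(1-4)] sum_arg ..
  finally show ?thesis
    by (simp add: theta_slice_add_arg card_ge_0_finite[OF assms(4)] exp_minus)
qed

section \<open>Products of \<open>\<vartheta>\<^sub>1\<close> and \<open>\<vartheta>\<^sub>2\<close>\<close>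

lemma bij_betw_case_sum_PiE:
  "bij_betw (\<lambda>(f, g). case_sum f g) (Pi\<^sub>E A (F \<circ> Inl) \<times> Pi\<^sub>E B (F \<circ> Inr)) (Pi\<^sub>E (A <+> B) F)"
proof (rule bij_betw_byWitness[where f' = "\<lambda>h. (h \<circ> Inl, h \<circ> Inr)"])
  show "(\<lambda>(f, g). case_sum f g) ` (Pi\<^sub>E A (F \<circ> Inl) \<times> Pi\<^sub>E B (F \<circ> Inr)) \<subseteq> Pi\<^sub>E (A <+> B) F"
    by (auto simp: PiE_iff extensional_def split: sum.split)
  show "(\<lambda>h. (h \<circ> Inl, h \<circ> Inr)) ` Pi\<^sub>E (A <+> B) F \<subseteq> Pi\<^sub>E A (F \<circ> Inl) \<times> Pi\<^sub>E B (F \<circ> Inr)"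
    by (auto simp: PiE_iff extensional_def)
qed (auto simp: fun_eq_iff split: sum.split)

definition theta12_sign :: "nat + nat \<Rightarrow> complex" where
  "theta12_sign = case_sum (\<lambda>_. -1) (\<lambda>_. 1)"

lemma prod_theta_term_same_sign:
  assumes "finite A" and "\<epsilon> \<noteq> 0"
  shows "(\<Prod>j\<in>A. theta_term \<epsilon> \<tau> (x j) (r j)) =
    \<epsilon> powi sum r A * q_pow \<tau> (of_int (\<Sum>j\<in>A. (r j)\<^sup>2)) * exp (2 * \<i> * (\<Sum>j\<in>A. of_int (r j) * x j))"
  using assms
  by (simp add: theta_term_def prod.distrib power_int_sum q_pow_sum exp_sum sum_distrib_left mult_ac)

lemma prod_theta12_term:
  "(\<Prod>i\<in>{1..a} <+> {1..b}. theta_term (theta12_sign i) \<tau> (case_sum x y i) (case_sum r s i)) =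
    (-1) powi (\<Sum>j=1..a. r j) *
    q_pow \<tau> (of_int ((\<Sum>j=1..a. (r j)\<^sup>2) + (\<Sum>j=1..b. (s j)\<^sup>2))) *
    exp (2 * \<i> * ((\<Sum>j=1..a. of_int (r j) * x j) + (\<Sum>j=1..b. of_int (s j) * y j)))"
  by (simp only: prod.Plus finite_atLeastAtMost theta12_sign_def sum.case o_def
      prod_theta_term_same_sign neg_equal_0_iff_equal one_neq_zero not_False_eq_True
      power_int_1_left of_int_add q_pow_add distrib_left exp_add mult_1 mult_ac)

lemma bij_betw_R12_index_tuples_with_sum:
  "bij_betw (\<lambda>(r, s). case_sum r s) (R12_index (2 * p) a b)
    (tuples_with_sum ({1..a} <+> {1..b}) (- int p))"
proof -
  have "R12_index (2 * p) a b = {c \<in> ({1..a} \<rightarrow>\<^sub>E UNIV) \<times> ({1..b} \<rightarrow>\<^sub>E UNIV).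
      sum (fst c) {1..a} + sum (snd c) {1..b} = - int p}"
    by (auto simp: R12_index_def)
  moreover have "bij_betw (\<lambda>(r, s). case_sum r s) (({1..a} \<rightarrow>\<^sub>E UNIV) \<times> ({1..b} \<rightarrow>\<^sub>E UNIV))
      ({1..a} <+> {1..b} \<rightarrow>\<^sub>E (UNIV :: int set))"
    using bij_betw_case_sum_PiE[of "{1..a}" "\<lambda>_. UNIV" "{1..b}"]
    by (simp only: o_def)
  ultimately show ?thesis
    unfolding tuples_with_sum_def
    by (auto simp: sum.Plus intro: bij_betw_Collect)
qed

lemma R12_eq_theta_slice:
  "R12 m (2 * p) a b x y \<tau> = of_nat (m * (2 * p)) * (- \<i>) ^ a * q_pow \<tau> (- (of_nat p / 2)) *
    theta_slice ({1..a} <+> {1..b}) theta12_sign \<tau> (case_sum x y) (- int p)"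
proof -
  have quarter: "real (2 * p) / 4 = of_nat p / 2"
    by simp
  show ?thesis
    unfolding R12_def quarter theta_slice_def
      infsum_reindex_bij_betw[OF bij_betw_R12_index_tuples_with_sum, symmetric]
    by (simp only: case_prod_unfold prod_theta12_term)
qed

lemma prod_jtheta12_eq_prod_theta_series:
  assumes "a + b = 2 * p" and "(\<Sum>j=1..a. x j) + (\<Sum>i=1..b. y i) = 0"
  shows "(\<Prod>j=1..a. jtheta1 (z + x j) \<tau>) * (\<Prod>i=1..b. jtheta2 (z + y i) \<tau>) =
    (- \<i>) ^ a * q_pow \<tau> (- (of_nat p / 2)) *
    (exp (2 * \<i> * of_nat p * (z + of_real pi * \<tau> / 2)) *
    (\<Prod>i\<in>{1..a} <+> {1..b}.
      theta_series (theta12_sign i) \<tau> (z + of_real pi * \<tau> / 2 + case_sum x y i)))"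
proof -
  have "(\<Prod>j=1..a. exp (\<i> * (z + x j))) * (\<Prod>i=1..b. exp (\<i> * (z + y i)))
      = exp (\<i> * (of_nat (a + b) * z + ((\<Sum>j=1..a. x j) + (\<Sum>i=1..b. y i))))"
    by (simp add: sum.distrib distrib_left distrib_right add_ac mult_ac
        flip: exp_sum exp_add sum_distrib_left)
  then have exps: "(\<Prod>j=1..a. exp (\<i> * (z + x j))) * (\<Prod>i=1..b. exp (\<i> * (z + y i)))
      = exp (2 * \<i> * of_nat p * z)"
    unfolding assms by (simp add: mult_ac)
  have "q_pow \<tau> (1/4) ^ a * q_pow \<tau> (1/4) ^ b = q_pow \<tau> (of_nat p / 2)"
    unfolding power_add[symmetric] assms(1)
    unfolding q_pow_power by simp
  then have prefactor: "q_pow \<tau> (1/4) ^ a * q_pow \<tau> (1/4) ^ b * exp (2 * \<i> * of_nat p * z) =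
      q_pow \<tau> (- (of_nat p / 2)) * exp (2 * \<i> * of_nat p * (z + of_real pi * \<tau> / 2))"
    by (simp add: q_pow_def algebra_simps flip: exp_add)
  have "(\<Prod>j=1..a. jtheta1 (z + x j) \<tau>) * (\<Prod>i=1..b. jtheta2 (z + y i) \<tau>) =
      (- \<i>) ^ a * (q_pow \<tau> (1/4) ^ a * q_pow \<tau> (1/4) ^ b *
      ((\<Prod>j=1..a. exp (\<i> * (z + x j))) * (\<Prod>i=1..b. exp (\<i> * (z + y i))))) *
      ((\<Prod>j=1..a. theta_series (-1) \<tau> (z + x j + of_real pi * \<tau> / 2)) *
       (\<Prod>i=1..b. theta_series 1 \<tau> (z + y i + of_real pi * \<tau> / 2)))"
    by (simp only: jtheta1_eq_theta_series jtheta2_eq_theta_series prod.distrib prod_constant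
        card_atLeastAtMost diff_Suc_1 power_mult_distrib mult_ac)
  then show ?thesis
    unfolding exps prefactor by (simp add: prod.Plus theta12_sign_def add_ac)
qed

lemma sum_prod_jtheta12:
  assumes "Im \<tau> > 0" and "even n" and "n > 0" and "m > 0" and "a + b = n"
    and "(\<Sum>j=1..a. x j) + (\<Sum>i=1..b. y i) = 0"
  defines "u \<equiv> \<lambda>k. of_nat k * of_real pi / of_nat (m * n)"
  shows "(\<Sum>k=0..<m * n.
      (\<Prod>j=1..a. jtheta1 (z + x j + u k) \<tau>) * (\<Prod>i=1..b. jtheta2 (z + y i + u k) \<tau>)) =
    R12 m n a b x y \<tau> *
    theta_series ((-1) ^ (m * a)) (of_nat (m\<^sup>2 * n) * \<tau>) (of_nat (m * n) * z)"
proof -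
  obtain p where n: "n = 2 * p"
    using assms(2) by (elim evenE)
  define I where "I = {1..a} <+> {1..b}"
  define v where "v = z + of_real pi * \<tau> / 2"
  define C where "C = (- \<i>) ^ a * q_pow \<tau> (- (of_nat p / 2))"
  have card: "card I = n"
    using assms(5) by (simp add: I_def card_Plus)
  have sum_w: "sum (case_sum x y) I = 0"
    using assms(6) by (simp add: I_def sum.Plus)
  have norm_sign: "\<forall>i\<in>I. norm (theta12_sign i) = 1"
    by (simp add: theta12_sign_def split: sum.split)
  have prod_sign: "prod theta12_sign I ^ m = (-1) ^ (m * a)"
    by (simp add: I_def theta12_sign_def prod.Plus mult.commute flip: power_mult)
  have arg: "of_nat (m * n) * v + of_nat m * of_int (- int p) * of_real pi * \<tau> = of_nat (m * n) * z"
    by (simp add: v_def n algebra_simps)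
  have summand: "(\<Prod>j=1..a. jtheta1 (z + x j + u k) \<tau>) * (\<Prod>i=1..b. jtheta2 (z + y i + u k) \<tau>) =
      C * (exp (- (2 * \<i> * of_int (- int p) * (v + u k))) *
      (\<Prod>i\<in>I. theta_series (theta12_sign i) \<tau> (v + u k + case_sum x y i)))" for k
    using prod_jtheta12_eq_prod_theta_series[OF assms(5)[unfolded n] assms(6), of "z + u k" \<tau>]
    by (simp add: I_def C_def v_def add_ac)
  have "(\<Sum>k=0..<m * n.
      (\<Prod>j=1..a. jtheta1 (z + x j + u k) \<tau>) * (\<Prod>i=1..b. jtheta2 (z + y i + u k) \<tau>)) =
      C * (of_nat (m * n) * theta_slice I theta12_sign \<tau> (case_sum x y) (- int p) *
      theta_series ((-1) ^ (m * a)) (of_nat (m\<^sup>2 * n) * \<tau>) (of_nat (m * n) * z))"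
    unfolding summand sum_distrib_left[symmetric]
    using sum_exp_mult_prod_theta_series_zero_sum[OF assms(1) norm_sign assms(4) _ sum_w,
        of "- int p" v] assms(3)
    unfolding card arg prod_sign u_def by simp
  then show ?thesis
    unfolding n R12_eq_theta_slice I_def C_def by (simp only: mult_ac)
qed

theorem theorem1p8:
  fixes m n a b :: nat and x y :: "nat \<Rightarrow> complex" and \<tau> z :: complex
  assumes "Im \<tau> > 0"
    and "even n" and "n > 0" and "m > 0"
    and "a + b = n"
    and "(\<Sum>j=1..a. x j) + (\<Sum>i=1..b. y i) = 0"
  shows "(even (m * a) \<longrightarrow>
            (\<Sum>k=0..<m * n.
               (\<Prod>j=1..a. jtheta1 (z + x j + of_nat k * of_real pi / of_nat (m * n)) \<tau>) *
               (\<Prod>i=1..b. jtheta2 (z + y i + of_nat k * of_real pi / of_nat (m * n)) \<tau>))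
            = R12 m n a b x y \<tau> * jtheta3 (of_nat (m * n) * z) (of_nat (m\<^sup>2 * n) * \<tau>)) \<and>
         (odd (m * a) \<longrightarrow>
            (\<Sum>k=0..<m * n.
               (\<Prod>j=1..a. jtheta1 (z + x j + of_nat k * of_real pi / of_nat (m * n)) \<tau>) *
               (\<Prod>i=1..b. jtheta2 (z + y i + of_nat k * of_real pi / of_nat (m * n)) \<tau>))
            = R12 m n a b x y \<tau> * jtheta4 (of_nat (m * n) * z) (of_nat (m\<^sup>2 * n) * \<tau>))"
  unfolding sum_prod_jtheta12[OF assms] jtheta3_eq_theta_series jtheta4_eq_theta_series
  by simp

end
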